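(* Let $r\ge 0$ be an integer and let $a,b$ be indeterminates. For all integers $n,m,k\ge 0$, $$\mathcal{G}_{a,b}(n+m,k;r)=\sum_{i=0}^n\sum_{j=0}^m \binom{n}{i}\,\mathcal{G}_{a,b}(m,j;r)\,\mathcal{G}_{a,b}(i,k-j;0)\prod_{\ell=0}^{n-i-1}\bigl(a\ell+a(m+r)+b(j+r)\bigr).$$
   Context: Write $[m]=\{1,\ldots,m\}$, $[0]=\varnothing$. A Lah distribution of $[m]$ into $\ell$ blocks is a partition of $[m]$ into $\ell$ non-empty, pairwise disjoint blocks in which the elements within each block are linearly ordered (the blocks themselves are not ordered). For integers $n,k,r$ with $0\le k\le n$ and $r\ge 0$, let $\mathcal{L}_r(n,k)$ be the set of Lah distributions of $[n+r]$ into $k+r$ blocks in which the elements of $[r]$ belong to distinct blocks. An element $i$ of a Lah distribution $\lambda$ is a record low if there is no element $j<i$ to the left of $i$ within its block. Let $rec^*(\lambda)$ be the number of record lows of $\lambda$ that are not the smallest element of their block, and let $nrec(\lambda)$ be the number of elements of the underlying set that are not record lows of $\lambda$. The generalized $r$-Lah number is the polynomial in indeterminates $a,b$ $$\mathcal{G}_{a,b}(n,k;r)=\sum_{\lambda\in\mathcal{L}_r(n,k)}a^{nrec(\lambda)}b^{rec^*(\lambda)},$$ with $\mathcal{G}_{a,b}(n,k;r)=0$ unless $0\le k\le n$ and $r\ge 0$. Empty sums are $0$ and empty products are $1$. *)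

theory Defs
  imports Main "HOL-Library.Disjoint_Sets"
begin

text \<open>A linearly ordered block is a duplicate-free list (read from left to right), and a
  distribution is a set of such lists. Injectivity of \<open>set\<close> says that each block of the
  partition carries exactly one linear order.\<close>

definition lah_distributions :: "nat \<Rightarrow> nat \<Rightarrow> nat list set set" where
  "lah_distributions m l =
    {D. partition_on {1..m} (set ` D) \<and> inj_on set D \<and> (\<forall>xs\<in>D. distinct xs) \<and> card D = l}"

definition r_lah_distributions :: "nat \<Rightarrow> nat \<Rightarrow> nat \<Rightarrow> nat list set set" where
  "r_lah_distributions r n k =
    {D \<in> lah_distributions (n + r) (k + r).
       \<forall>i\<in>{1..r}. \<forall>j\<in>{1..r}. i \<noteq> j \<longrightarrow> \<not> (\<exists>xs\<in>D. i \<in> set xs \<and> j \<in> set xs)}"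

definition record_lows :: "nat list set \<Rightarrow> nat set" where
  "record_lows D =
    {i. \<exists>xs\<in>D. \<exists>p<length xs. xs ! p = i \<and> \<not> (\<exists>q<p. xs ! q < i)}"

definition rec_star :: "nat list set \<Rightarrow> nat" where
  "rec_star D = card {i \<in> record_lows D. \<exists>xs\<in>D. i \<in> set xs \<and> i \<noteq> Min (set xs)}"

definition nrec :: "nat list set \<Rightarrow> nat" where
  "nrec D = card ((\<Union>xs\<in>D. set xs) - record_lows D)"

text \<open>The polynomial evaluated at arbitrary elements \<open>a\<close>, \<open>b\<close> of a commutative semiring; taking
  for them the two indeterminates of a bivariate polynomial ring gives the polynomial itself.
  The integer indices allow the convention that it is \<open>0\<close> outside the stated range.\<close>

definition gen_r_lah :: "'a::comm_semiring_1 \<Rightarrow> 'a \<Rightarrow> int \<Rightarrow> int \<Rightarrow> int \<Rightarrow> 'a" where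
  "gen_r_lah a b n k r =
    (if 0 \<le> k \<and> k \<le> n \<and> 0 \<le> r
     then \<Sum>D\<in>r_lah_distributions (nat r) (nat n) (nat k). a ^ nrec D * b ^ rec_star D
     else 0)"

text \<open>The sum above ranges over a finite set, so it is not the default value \<open>0\<close>.\<close>

lemma finite_lah_distributions: "finite (lah_distributions m l)"
proof (rule finite_subset)
  let ?X = "{xs. set xs \<subseteq> {1..m} \<and> length xs \<le> m}"
  show "lah_distributions m l \<subseteq> Pow ?X"
  proof (intro subsetI PowI CollectI conjI)
    fix D xs x assume *: "D \<in> lah_distributions m l" "xs \<in> D"
    then have sub: "set xs \<subseteq> {1..m}" and "distinct xs"
      by (auto simp: lah_distributions_def partition_on_def)
    then show "length xs \<le> m"
      using card_mono[OF _ sub] by (simp add: distinct_card)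
    show "x \<in> {1..m}" if "x \<in> set xs" using sub that by blast
  qed
  show "finite (Pow ?X)"
    by (simp add: finite_lists_length_le)
qed

lemma finite_r_lah_distributions: "finite (r_lah_distributions r n k)"
  by (rule finite_subset[OF _ finite_lah_distributions]) (auto simp: r_lah_distributions_def)

end

(* Removing the largest element N + 1 from a distribution of [N + 1] into l blocks leaves either
   l - 1 blocks, when it forms a block of its own, or a distribution of [N] into l blocks.
   In the latter case it stood either directly after one of the N other elements, where it is not
   a record low (weight a), or in front of one of the l blocks, where it is a record low but not
   the minimum (weight b).  Hence, with N = n + r and l = k + r,
     G(n+1, k; r) = G(n, k-1; r) + (a n + b k + x) G(n, k; r)   for x = a r + b r.
   Write H_x(n, k) for the solution of this recurrence with arbitrary x.  Continuing the recurrence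
   from row m splits H_x(n+m, k) into contributions H_x(m, j) H_y(n, k-j) with y = a m + b j + x,
   and H_y expands binomially in H_0 and the rising products of a l + y. *)
theory Submission
  imports Defs
begin

section \<open>Record lows of a single block\<close>

definition block_records :: "nat list \<Rightarrow> nat set" where
  "block_records xs = {i. \<exists>p<length xs. xs ! p = i \<and> \<not> (\<exists>q<p. xs ! q < i)}"

lemma block_records_Nil [simp]: "block_records [] = {}"
  by (simp add: block_records_def)

text \<open>The head disqualifies exactly the later elements that are strictly greater than it. This
  recursion makes record lows accessible to induction over lists.\<close>

lemma block_records_Cons [simp]:
  "block_records (x # xs) = insert x {i \<in> block_records xs. i \<le> x}"
proof (rule set_eqI)
  fix i
  have "i \<in> block_records (x # xs) \<longleftrightarrow>
      x = i \<or> (\<exists>p<length xs. xs ! p = i \<and> \<not> (x < i \<or> (\<exists>q<p. xs ! q < i)))"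
    by (simp add: block_records_def Ex_less_Suc2 del: de_Morgan_disj not_ex not_less)
  then show "i \<in> block_records (x # xs) \<longleftrightarrow> i \<in> insert x {i \<in> block_records xs. i \<le> x}"
    unfolding block_records_def by (simp only: insert_iff mem_Collect_eq) (metis not_less)
qed

lemma block_records_subset: "block_records xs \<subseteq> set xs"
  by (auto simp: block_records_def)

text \<open>An element greater than all others never stops another one from being a record low. At
  the front it is a record low itself; anywhere else the head of \<open>us\<close> is a smaller
  element to its left.\<close>

lemma block_records_insert_greater:
  assumes "\<forall>x\<in>set us \<union> set ws. x < v"
  shows "block_records (us @ v # ws) =
    (if us = [] then insert v (block_records ws) else block_records (us @ ws))"
  using assms
proof (induction us)
  case Nil
  then have "x \<le> v" if "x \<in> block_records ws" for x
    using that block_records_subset[of ws] by (blast intro: less_imp_le)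
  then show ?case by auto
next
  case (Cons u us)
  have "\<not> v \<le> u" using Cons.prems by simp
  moreover have IH: "block_records (us @ v # ws) =
      (if us = [] then insert v (block_records ws) else block_records (us @ ws))"
    using Cons.prems by (intro Cons.IH) simp
  ultimately show ?case
    unfolding append_Cons block_records_Cons IH by auto
qed

text \<open>Keeping this set apart from the record lows allows the effect of an insertion to be
  followed on each of the two separately.\<close>

definition nonmins :: "nat list set \<Rightarrow> nat set" where
  "nonmins D = (\<Union>xs\<in>D. set xs - {Min (set xs)})"

lemma record_lows_eq: "record_lows D = (\<Union>xs\<in>D. block_records xs)"
  by (auto simp: record_lows_def block_records_def)

lemma rec_star_eq: "rec_star D = card (record_lows D \<inter> nonmins D)"
  by (auto simp: rec_star_def nonmins_def intro!: arg_cong[of _ _ card])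

section \<open>Distributions as disjoint families of lists\<close>

text \<open>For non-empty lists, disjointness of the family \<open>set\<close> on \<open>D\<close>
  yields both disjoint blocks and injectivity of \<open>set\<close>, as two lists with the same
  non-empty set are not disjoint. A condition on pairs of lists is easy to check when one block is
  added, removed or changed.\<close>

lemma lah_distributions_iff:
  "D \<in> lah_distributions m l \<longleftrightarrow>
    finite D \<and> (\<Union>xs\<in>D. set xs) = {1..m} \<and> [] \<notin> D \<and> (\<forall>xs\<in>D. distinct xs)
      \<and> disjoint_family_on set D \<and> card D = l"
  (is "_ \<longleftrightarrow> ?R")
proof
  assume "D \<in> lah_distributions m l"
  then have *: "partition_on {1..m} (set ` D)" "inj_on set D" "\<forall>xs\<in>D. distinct xs" "card D = l"
    by (simp_all add: lah_distributions_def)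
  have "finite (set ` D)"
    using finite_elements[OF _ *(1)] by simp
  then have "finite D" using *(2) finite_imageD by blast
  moreover have "disjoint_family_on set D"
    unfolding disjoint_family_on_def
  proof (intro ballI impI)
    fix xs ys assume "xs \<in> D" "ys \<in> D" "xs \<noteq> ys"
    then have "set xs \<noteq> set ys" using *(2) by (simp add: inj_on_eq_iff)
    then show "set xs \<inter> set ys = {}"
      using disjointD[OF partition_onD2[OF *(1)]] \<open>xs \<in> D\<close> \<open>ys \<in> D\<close> by simp
  qed
  moreover have "[] \<notin> D" using partition_onD3[OF *(1)] by force
  ultimately show ?R
    using *(3,4) partition_onD1[OF *(1)] by simp
next
  assume R: ?R
  have disj: "set xs \<inter> set ys = {}" if "xs \<in> D" "ys \<in> D" "xs \<noteq> ys" for xs ys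
    using R that by (simp add: disjoint_family_on_def)
  have nonempty: "set xs \<noteq> {}" if "xs \<in> D" for xs
    using R that by auto
  have "inj_on set D"
  proof (rule inj_onI, rule ccontr)
    fix xs ys assume "xs \<in> D" "ys \<in> D" "set xs = set ys" "xs \<noteq> ys"
    with disj[of xs ys] nonempty[of xs] show False by simp
  qed
  moreover have "partition_on {1..m} (set ` D)"
  proof (rule partition_onI)
    show "\<Union> (set ` D) = {1..m}" using R by simp
    show "disjnt p q" if "p \<in> set ` D" "q \<in> set ` D" "p \<noteq> q" for p q
      using that disj unfolding disjnt_def by blast
    show "{} \<notin> set ` D" using nonempty by blast
  qed
  ultimately show "D \<in> lah_distributions m l"
    using R by (simp add: lah_distributions_def)
qed

text \<open>The size \<open>N\<close> and the number of blocks \<open>l\<close> are parameters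
  independent of \<open>r\<close>, so that a recurrence can lower them one at a time while
  \<open>r\<close> stays fixed.\<close>

definition separated_lah :: "nat \<Rightarrow> nat \<Rightarrow> nat \<Rightarrow> nat list set set" where
  "separated_lah r N l =
    {D \<in> lah_distributions N l. \<forall>xs\<in>D. \<forall>i\<in>set xs. \<forall>j\<in>set xs. i \<le> r \<longrightarrow> j \<le> r \<longrightarrow> i = j}"

lemma r_lah_distributions_eq: "r_lah_distributions r n k = separated_lah r (n + r) (k + r)"
proof -
  have "(\<forall>i\<in>{1..r}. \<forall>j\<in>{1..r}. i \<noteq> j \<longrightarrow> \<not> (\<exists>xs\<in>D. i \<in> set xs \<and> j \<in> set xs)) \<longleftrightarrow>
      (\<forall>xs\<in>D. \<forall>i\<in>set xs. \<forall>j\<in>set xs. i \<le> r \<longrightarrow> j \<le> r \<longrightarrow> i = j)"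
    if "D \<in> lah_distributions (n + r) (k + r)" for D
  proof -
    \<comment> \<open>All elements are positive, so being at most \<open>r\<close> is the same as
      lying in \<open>{1..r}\<close>.\<close>
    have "1 \<le> i" if "xs \<in> D" "i \<in> set xs" for xs i
      using that \<open>D \<in> _\<close> by (auto simp: lah_distributions_iff)
    then show ?thesis by (meson atLeastAtMost_iff)
  qed
  then show ?thesis
    unfolding r_lah_distributions_def separated_lah_def by blast
qed

lemma finite_separated_lah: "finite (separated_lah r N l)"
  by (rule finite_subset[OF _ finite_lah_distributions[of N l]]) (auto simp: separated_lah_def)

lemma separated_lahD:
  assumes "D \<in> separated_lah r N l"
  shows "finite D" "(\<Union>xs\<in>D. set xs) = {1..N}" "[] \<notin> D" "\<And>xs. xs \<in> D \<Longrightarrow> distinct xs"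
    "disjoint_family_on set D" "card D = l"
    "\<And>xs i j. xs \<in> D \<Longrightarrow> i \<in> set xs \<Longrightarrow> j \<in> set xs \<Longrightarrow> i \<le> r \<Longrightarrow> j \<le> r \<Longrightarrow> i = j"
    "\<And>xs x. xs \<in> D \<Longrightarrow> x \<in> set xs \<Longrightarrow> 1 \<le> x \<and> x \<le> N"
  using assms by (auto simp: separated_lah_def lah_distributions_iff)

lemma Suc_notin_separated_lah: "D \<in> separated_lah r N l \<Longrightarrow> xs \<in> D \<Longrightarrow> Suc N \<notin> set xs"
  by (auto dest: separated_lahD(8))

text \<open>Used to count the places directly behind some element: over all blocks there are
  \<open>N\<close> of them.\<close>

lemma sum_length_separated_lah:
  assumes "D \<in> separated_lah r N l"
  shows "(\<Sum>xs\<in>D. length xs) = N"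
proof -
  have "(\<Sum>xs\<in>D. length xs) = (\<Sum>xs\<in>D. card (set xs))"
    by (intro sum.cong) (auto simp: distinct_card separated_lahD(4)[OF assms])
  also have "\<dots> = card (\<Union>xs\<in>D. set xs)"
    using separated_lahD(1,5)[OF assms]
    by (intro card_UN_disjoint[symmetric]) (auto simp: disjoint_family_on_def)
  finally show ?thesis by (simp add: separated_lahD(2)[OF assms])
qed

section \<open>Inserting and removing the largest element\<close>

definition insert_at :: "nat \<Rightarrow> 'a \<Rightarrow> 'a list \<Rightarrow> 'a list" where
  "insert_at p v xs = take p xs @ v # drop p xs"

lemma set_insert_at [simp]: "set (insert_at p v xs) = insert v (set xs)"
  by (simp add: insert_at_def) (metis append_take_drop_id set_append)

text \<open>Since \<open>v\<close> occurs only once in the result, it determines what stands before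
  and after it. The bounds on \<open>p\<close> and \<open>q\<close> make the length of the prefix
  equal to the position.\<close>

lemma insert_at_inject:
  assumes "v \<notin> set xs" "v \<notin> set ys" "p \<le> length xs" "q \<le> length ys"
    and "insert_at p v xs = insert_at q v ys"
  shows "p = q" "xs = ys"
proof -
  have "v \<notin> set (take p xs)" "v \<notin> set (take q ys)" "v \<notin> set (drop p xs)" "v \<notin> set (drop q ys)"
    using assms(1,2) by (auto dest: in_set_takeD in_set_dropD)
  then have *: "take p xs = take q ys" "drop p xs = drop q ys"
    using assms(5) append_Cons_eq_iff[of v "take p xs" "drop p xs" "take q ys" "drop q ys"]
    by (auto simp: insert_at_def)
  show "p = q" using assms(3,4) arg_cong[OF *(1), of length] by simp
  show "xs = ys" using * by (metis append_take_drop_id)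
qed

lemma distinct_insert_at: "v \<notin> set xs \<Longrightarrow> distinct xs \<Longrightarrow> distinct (insert_at p v xs)"
  by (simp add: insert_at_def set_take_disj_set_drop_if_distinct)
     (meson in_set_dropD in_set_takeD)

definition insert_into :: "nat \<Rightarrow> nat list set \<Rightarrow> nat list \<Rightarrow> nat \<Rightarrow> nat list set" where
  "insert_into v D xs p = insert (insert_at p v xs) (D - {xs})"

lemma insert_singleton_separated_lah:
  assumes "r \<le> N" "D \<in> separated_lah r N l"
  shows "insert [Suc N] D \<in> separated_lah r (Suc N) (Suc l)"
proof -
  note D = separated_lahD[OF assms(2)]
  have v: "Suc N \<notin> set xs" if "xs \<in> D" for xs
    using assms(2) that by (rule Suc_notin_separated_lah)
  then have "[Suc N] \<notin> D" by force
  then show ?thesis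
    using D(1-6) D(7) v assms(1)
    by (auto simp: separated_lah_def lah_distributions_iff disjoint_family_on_def)
qed

text \<open>By \<open>r \<le> N\<close> the new element exceeds \<open>r\<close> and cannot violate
  the separation. The lengthened list contains \<open>Suc N\<close>, hence is not in
  \<open>D\<close>, and the number of blocks is preserved.\<close>

lemma insert_into_separated_lah:
  assumes "r \<le> N" "D \<in> separated_lah r N l" "xs \<in> D"
  shows "insert_into (Suc N) D xs p \<in> separated_lah r (Suc N) l"
proof -
  note D = separated_lahD[OF assms(2)]
  have v: "Suc N \<notin> set ys" if "ys \<in> D" for ys
    using assms(2) that by (rule Suc_notin_separated_lah)
  have notin: "insert_at p (Suc N) xs \<notin> D"
    using v[of "insert_at p (Suc N) xs"] by auto
  have "(\<Union>ys\<in>insert_into (Suc N) D xs p. set ys) = insert (Suc N) (\<Union>ys\<in>D. set ys)"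
    using assms(3) by (auto simp: insert_into_def)
  moreover have "card (insert_into (Suc N) D xs p) = l"
    using notin D(1,6) assms(3) card_Suc_Diff1 by (fastforce simp: insert_into_def)
  moreover have "disjoint_family_on set (insert_into (Suc N) D xs p)"
    using D(5) v assms(3) unfolding insert_into_def disjoint_family_on_def by auto
  moreover have "[] \<notin> insert_into (Suc N) D xs p"
    using D(3) by (auto simp: insert_into_def insert_at_def)
  moreover have "\<forall>ys\<in>insert_into (Suc N) D xs p. distinct ys"
    using D(4) v assms(3) by (auto simp: insert_into_def distinct_insert_at)
  moreover have "\<forall>ys\<in>insert_into (Suc N) D xs p. \<forall>i\<in>set ys. \<forall>j\<in>set ys. i \<le> r \<longrightarrow> j \<le> r \<longrightarrow> i = j"
    using D(7) assms(1,3) by (auto simp: insert_into_def)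
  ultimately show ?thesis
    using D(1,2) by (auto simp: separated_lah_def lah_distributions_iff insert_into_def)
qed

text \<open>Delete \<open>Suc N\<close> from the block \<open>ys\<close> that holds it. Either
  nothing is left of this block, or a non-empty block remains and the former place of
  \<open>Suc N\<close> supplies \<open>p\<close>.\<close>

lemma separated_lah_Suc_cases:
  assumes "r \<le> N" "E \<in> separated_lah r (Suc N) l"
  obtains (singleton) D l' where "l = Suc l'" "D \<in> separated_lah r N l'" "E = insert [Suc N] D"
  | (into) D xs p where "D \<in> separated_lah r N l" "xs \<in> D" "p \<le> length xs"
      "E = insert_into (Suc N) D xs p"
proof -
  note E = separated_lahD[OF assms(2)]
  have "Suc N \<in> (\<Union>xs\<in>E. set xs)" using E(2) by auto
  then obtain ys where ys: "ys \<in> E" "Suc N \<in> set ys" by blast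
  then obtain us ws where uw: "ys = us @ Suc N # ws" by (auto simp: in_set_conv_decomp)
  have v: "Suc N \<notin> set zs" if "zs \<in> E - {ys}" for zs
    using E(5) that ys by (auto simp: disjoint_family_on_def)
  have vu: "Suc N \<notin> set (us @ ws)" using E(4)[OF ys(1)] uw by auto
  have union: "set (us @ ws) \<union> (\<Union>zs\<in>E - {ys}. set zs) = {1..N}"
  proof -
    have "set (us @ ws) \<union> (\<Union>zs\<in>E - {ys}. set zs) = (\<Union>zs\<in>E. set zs) - {Suc N}"
      using ys(1) uw vu v by auto
    then show ?thesis using E(2) by auto
  qed
  show ?thesis
  proof (cases "us @ ws = []")
    case True
    have "disjoint_family_on set (E - {ys})"
      using E(5) by (auto simp: disjoint_family_on_def)
    moreover have "(\<Union>zs\<in>E - {ys}. set zs) = {1..N}" using union True by simp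
    moreover have "\<forall>zs\<in>E - {ys}. \<forall>i\<in>set zs. \<forall>j\<in>set zs. i \<le> r \<longrightarrow> j \<le> r \<longrightarrow> i = j"
      using E(7) by blast
    \<comment> \<open>The subtraction is not truncated: \<open>ys\<close> belongs to
      \<open>E\<close>, so \<open>l\<close> is positive.\<close>
    ultimately have "E - {ys} \<in> separated_lah r N (l - 1)"
      using E(1,3,4,6) ys(1) by (simp add: separated_lah_def lah_distributions_iff)
    moreover have "l = Suc (l - 1)"
      using E(1,6) ys(1) card_Suc_Diff1[of E ys] by simp
    moreover have "E = insert [Suc N] (E - {ys})"
      using True uw insert_Diff[OF ys(1)] by simp
    ultimately show ?thesis using singleton by blast
  next
    case False
    let ?xs = "us @ ws"
    let ?D = "insert ?xs (E - {ys})"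
    have disj: "set ?xs \<inter> set zs = {}" if "zs \<in> E - {ys}" for zs
    proof -
      have "set ys \<inter> set zs = {}"
        using E(5) that ys(1) unfolding disjoint_family_on_def by blast
      then show ?thesis using uw by auto
    qed
    \<comment> \<open>If the shortened block coincided with another one, the number of blocks would
      drop; but it is non-empty and disjoint from all the others.\<close>
    have notin: "?xs \<notin> E - {ys}"
    proof
      assume "?xs \<in> E - {ys}"
      then have "set ?xs \<inter> set ?xs = {}" by (rule disj)
      then show False using False by simp
    qed
    have "card ?D = l"
      using notin E(1,6) ys(1) card_Suc_Diff1[of E ys] by simp
    moreover have "disjoint_family_on set ?D"
      using E(5) disj unfolding disjoint_family_on_def by blast
    moreover have "(\<Union>zs\<in>?D. set zs) = {1..N}" using union by simp
    moreover have "\<forall>zs\<in>?D. distinct zs" using E(4) E(4)[OF ys(1)] uw by auto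
    moreover have "\<forall>zs\<in>?D. \<forall>i\<in>set zs. \<forall>j\<in>set zs. i \<le> r \<longrightarrow> j \<le> r \<longrightarrow> i = j"
    proof -
      have "set ?xs \<subseteq> set ys" using uw by auto
      then show ?thesis using E(7) ys(1) by blast
    qed
    ultimately have "?D \<in> separated_lah r N l"
      using E(1,3) False by (simp add: separated_lah_def lah_distributions_iff)
    moreover have "E = insert_into (Suc N) ?D ?xs (length us)"
      using insert_Diff[OF ys(1)] uw notin by (simp add: insert_into_def insert_at_def)
    ultimately show ?thesis using into[of ?D ?xs "length us"] by simp
  qed
qed

section \<open>Effect of an insertion on the weight\<close>

definition weight :: "'a::comm_semiring_1 \<Rightarrow> 'a \<Rightarrow> nat list set \<Rightarrow> 'a" where
  "weight a b D = a ^ nrec D * b ^ rec_star D"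

lemma record_lows_subset: "record_lows D \<subseteq> (\<Union>xs\<in>D. set xs)"
  using block_records_subset by (fastforce simp: record_lows_eq)

text \<open>Alone in its block, \<open>Suc N\<close> is both a record low and the minimum, so it
  raises neither exponent.\<close>

lemma weight_insert_singleton:
  assumes "D \<in> separated_lah r N l"
  shows "weight a b (insert [Suc N] D) = weight a b D"
proof -
  have notin: "Suc N \<notin> (\<Union>xs\<in>D. set xs)" using separated_lahD(2)[OF assms] by simp
  have rl: "record_lows (insert [Suc N] D) = insert (Suc N) (record_lows D)"
    by (auto simp: record_lows_eq)
  have nm: "nonmins (insert [Suc N] D) = nonmins D"
    by (simp add: nonmins_def)
  have "Suc N \<notin> nonmins D" using notin by (auto simp: nonmins_def)
  then have "rec_star (insert [Suc N] D) = rec_star D"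
    by (simp add: rec_star_eq rl nm)
  moreover have "nrec (insert [Suc N] D) = nrec D"
    using notin unfolding nrec_def rl by (intro arg_cong[of _ _ card]) auto
  ultimately show ?thesis by (simp add: weight_def)
qed

text \<open>The new maximum changes neither the minimum of its non-empty block nor the status of the
  other elements. At the front it is a record low but not the minimum and raises
  \<open>rec_star\<close>; elsewhere it is no record low and raises \<open>nrec\<close>.\<close>

lemma weight_insert_into:
  assumes "D \<in> separated_lah r N l" "xs \<in> D" "p \<le> length xs"
  shows "weight a b (insert_into (Suc N) D xs p) = (if p = 0 then b else a) * weight a b D"
proof -
  note D = separated_lahD[OF assms(1)]
  let ?v = "Suc N" and ?E = "insert_into (Suc N) D xs p"
  have fin: "finite (\<Union>xs\<in>D. set xs)" using D(2) by simp
  have notin: "?v \<notin> (\<Union>xs\<in>D. set xs)" using D(2) by simp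
  have xs: "xs \<noteq> []" using D(3) assms(2) by auto
  have less: "x < ?v" if "x \<in> set xs" for x using D(8)[OF assms(2) that] by simp
  have "\<forall>x\<in>set (take p xs) \<union> set (drop p xs). x < ?v"
    using less by (auto dest: in_set_takeD in_set_dropD)
  from block_records_insert_greater[OF this]
  have "block_records (insert_at p ?v xs) =
      (if p = 0 then insert ?v (block_records xs) else block_records xs)"
    using xs by (simp add: insert_at_def)
  then have rl: "record_lows ?E = (if p = 0 then insert ?v (record_lows D) else record_lows D)"
    using assms(2) by (auto simp: record_lows_eq insert_into_def)
  have m: "Min (set xs) < ?v" using xs by (intro less Min_in) simp_all
  have "Min (insert ?v (set xs)) = Min (set xs)"
    using Min_insert[of "set xs" ?v] min_absorb2[OF less_imp_le[OF m]] xs by simp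
  then have "set (insert_at p ?v xs) - {Min (set (insert_at p ?v xs))}
      = insert ?v (set xs - {Min (set xs)})"
    using m by auto
  then have nm: "nonmins ?E = insert ?v (nonmins D)"
    using assms(2) unfolding nonmins_def insert_into_def by auto
  have un: "(\<Union>xs\<in>?E. set xs) = insert ?v (\<Union>xs\<in>D. set xs)"
    using assms(2) by (auto simp: insert_into_def)
  have v: "?v \<notin> record_lows D" "finite (record_lows D)"
    using record_lows_subset[of D] notin fin finite_subset by auto
  show ?thesis
  proof (cases "p = 0")
    case True
    have "nrec ?E = nrec D"
      using notin rl True un unfolding nrec_def by (intro arg_cong[of _ _ card]) auto
    moreover have "rec_star ?E = Suc (rec_star D)"
      using True rl nm v by (simp add: rec_star_eq)
    ultimately show ?thesis using True by (simp add: weight_def ac_simps)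
  next
    case False
    have "nrec ?E = Suc (nrec D)"
      using notin rl False un v fin by (simp add: nrec_def insert_Diff_if)
    moreover have "rec_star ?E = rec_star D"
      using False rl nm v by (simp add: rec_star_eq)
    ultimately show ?thesis using False by (simp add: weight_def ac_simps)
  qed
qed

section \<open>Recurrence for the total weight\<close>

text \<open>The lengthened block is recognized in the result as the only one containing
  \<open>Suc N\<close>. Hence it agrees on both sides, and so do the remaining blocks.\<close>

lemma insert_into_inject:
  assumes "D \<in> separated_lah r N l" "xs \<in> D" "p \<le> length xs"
    and "D' \<in> separated_lah r N l" "xs' \<in> D'" "p' \<le> length xs'"
    and eq: "insert_into (Suc N) D xs p = insert_into (Suc N) D' xs' p'"
  shows "D = D' \<and> xs = xs' \<and> p = p'"
proof -
  let ?ys = "insert_at p (Suc N) xs" and ?ys' = "insert_at p' (Suc N) xs'"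
  have notin: "?ys \<notin> D" "?ys \<notin> D'"
    using Suc_notin_separated_lah[OF assms(1), of ?ys] Suc_notin_separated_lah[OF assms(4), of ?ys]
    by auto
  have "?ys \<in> insert ?ys' (D' - {xs'})"
    using eq unfolding insert_into_def by blast
  with notin(2) have ys: "?ys = ?ys'" by blast
  have v: "Suc N \<notin> set xs" "Suc N \<notin> set xs'"
    using Suc_notin_separated_lah assms(1,2,4,5) by blast+
  note * = insert_at_inject[OF v assms(3,6) ys]
  have "insert ?ys (D - {xs}) = insert ?ys (D' - {xs'})"
    using eq unfolding insert_into_def ys .
  then have "D - {xs} = D' - {xs'}"
    using notin by (subst (asm) insert_ident) simp_all
  then have "insert xs (D - {xs}) = insert xs' (D' - {xs'})"
    unfolding * by simp
  then have "D = D'" unfolding insert_Diff[OF assms(2)] insert_Diff[OF assms(5)] .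
  with * show ?thesis by simp
qed

definition total_weight :: "'a::comm_semiring_1 \<Rightarrow> 'a \<Rightarrow> nat \<Rightarrow> nat \<Rightarrow> nat \<Rightarrow> 'a" where
  "total_weight a b r N l = (\<Sum>D\<in>separated_lah r N l. weight a b D)"

text \<open>The two ways of adding \<open>Suc N\<close> are injective, have disjoint images and
  together produce every distribution, so the sum splits into two reindexed sums. For
  \<open>l = 0\<close> there is no distribution with one block fewer.\<close>

lemma total_weight_Suc:
  assumes "r \<le> N"
  shows "total_weight a b r (Suc N) l =
    (case l of 0 \<Rightarrow> 0 | Suc l' \<Rightarrow> total_weight a b r N l')
      + (a * of_nat N + b * of_nat l) * total_weight a b r N l"
proof -
  let ?v = "Suc N"
  let ?S = "case l of 0 \<Rightarrow> {} | Suc l' \<Rightarrow> separated_lah r N l'"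
  \<comment> \<open>Position 0 is the front of a block and position \<open>p > 0\<close> the place
    behind its \<open>p\<close>-th element, which gives \<open>length xs + 1\<close> places.\<close>
  let ?T = "SIGMA D:separated_lah r N l. SIGMA xs:D. {..length xs}"
  let ?f = "\<lambda>(D, xs, p). insert_into ?v D xs p"
  have split: "separated_lah r ?v l = insert [?v] ` ?S \<union> ?f ` ?T"
  proof (intro set_eqI iffI)
    fix E assume "E \<in> separated_lah r ?v l"
    with assms show "E \<in> insert [?v] ` ?S \<union> ?f ` ?T"
    proof (cases rule: separated_lah_Suc_cases)
      case (into D xs p)
      then have "(D, xs, p) \<in> ?T" by simp
      then show ?thesis using into(4) by (intro UnI2 image_eqI[where x = "(D, xs, p)"]) simp_all
    qed auto
  next
    fix E assume "E \<in> insert [?v] ` ?S \<union> ?f ` ?T"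
    then show "E \<in> separated_lah r ?v l"
    proof
      assume "E \<in> insert [?v] ` ?S"
      then show ?thesis
        using insert_singleton_separated_lah[OF assms] by (auto split: nat.splits)
    next
      assume "E \<in> ?f ` ?T"
      then obtain D xs p where "D \<in> separated_lah r N l" "xs \<in> D" "E = insert_into ?v D xs p"
        by auto
      then show ?thesis using insert_into_separated_lah[OF assms] by simp
    qed
  qed
  have finS: "finite ?S" by (auto split: nat.splits simp: finite_separated_lah)
  have finT: "finite ?T"
    by (intro finite_SigmaI finite_separated_lah) (simp_all add: separated_lahD(1))
  have notin: "[?v] \<notin> D" if "D \<in> separated_lah r N l'" for D l'
    using Suc_notin_separated_lah[OF that, of "[?v]"] by auto
  have "inj_on (insert [?v]) (separated_lah r N l')" for l'
    by (rule inj_onI) (metis insert_ident notin)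
  then have injS: "inj_on (insert [?v]) ?S"
    by (simp split: nat.split)
  have injT: "inj_on ?f ?T"
  proof (rule inj_onI)
    fix s t assume "s \<in> ?T" "t \<in> ?T" "?f s = ?f t"
    moreover obtain D xs p D' xs' p' where "s = (D, xs, p)" "t = (D', xs', p')"
      by (metis prod_cases3)
    ultimately show "s = t"
      using insert_into_inject[of D r N l xs p D' xs' p'] by simp
  qed
  \<comment> \<open>The block \<open>[Suc N]\<close> tells the two images apart: an insertion
    producing it would have to start from an empty block.\<close>
  have "[?v] \<notin> insert_into ?v D xs p" if D: "D \<in> separated_lah r N l" "xs \<in> D" for D xs p
  proof
    assume "[?v] \<in> insert_into ?v D xs p"
    with notin[OF D(1)] have "insert_at p ?v xs = [?v]" unfolding insert_into_def by (metis Diff_iff insertE)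
    then have "xs = []" by (cases "drop p xs"; cases "take p xs") (simp_all add: insert_at_def)
    with D separated_lahD(3) show False by blast
  qed
  then have "[?v] \<notin> E" if "E \<in> ?f ` ?T" for E
    using that by (elim imageE SigmaE) simp
  moreover have "[?v] \<in> E" if "E \<in> insert [?v] ` ?S" for E
    using that by (elim imageE) simp
  ultimately have disj: "insert [?v] ` ?S \<inter> ?f ` ?T = {}"
    by (intro equals0I) (elim IntE, meson)
  have "total_weight a b r ?v l = (\<Sum>D\<in>?S. weight a b (insert [?v] D)) + (\<Sum>t\<in>?T. weight a b (?f t))"
    unfolding total_weight_def split
      sum.union_disjoint[OF finite_imageI[OF finS] finite_imageI[OF finT] disj]
      sum.reindex[OF injS] sum.reindex[OF injT] comp_def ..
  also have "(\<Sum>D\<in>?S. weight a b (insert [?v] D)) = (\<Sum>D\<in>?S. weight a b D)"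
    by (intro sum.cong) (auto split: nat.splits simp: weight_insert_singleton)
  also have "\<dots> = (case l of 0 \<Rightarrow> 0 | Suc l' \<Rightarrow> total_weight a b r N l')"
    by (simp add: total_weight_def split: nat.splits)
  also have "(\<Sum>t\<in>?T. weight a b (?f t)) =
      (\<Sum>D\<in>separated_lah r N l. \<Sum>xs\<in>D. \<Sum>p\<le>length xs. weight a b (insert_into ?v D xs p))"
  proof -
    have "(\<Sum>xs\<in>D. \<Sum>p\<le>length xs. weight a b (insert_into ?v D xs p))
        = (\<Sum>(xs, p)\<in>(SIGMA xs:D. {..length xs}). weight a b (insert_into ?v D xs p))"
      if "D \<in> separated_lah r N l" for D
      using separated_lahD(1)[OF that] by (intro sum.Sigma) simp_all
    then have "(\<Sum>D\<in>separated_lah r N l. \<Sum>xs\<in>D. \<Sum>p\<le>length xs. weight a b (insert_into ?v D xs p))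
        = (\<Sum>D\<in>separated_lah r N l.
            \<Sum>(xs, p)\<in>(SIGMA xs:D. {..length xs}). weight a b (insert_into ?v D xs p))"
      by (rule sum.cong[OF refl])
    also have "\<dots> = (\<Sum>(D, xs, p)\<in>?T. weight a b (insert_into ?v D xs p))"
      by (intro sum.Sigma) (simp_all add: finite_separated_lah separated_lahD(1))
    also have "\<dots> = (\<Sum>t\<in>?T. weight a b (?f t))"
      by (simp add: split_def)
    finally show ?thesis ..
  qed
  also have "\<dots> = (\<Sum>D\<in>separated_lah r N l. (a * of_nat N + b * of_nat l) * weight a b D)"
  proof (rule sum.cong[OF refl])
    fix D assume D: "D \<in> separated_lah r N l"
    have "(\<Sum>p\<le>length xs. weight a b (insert_into ?v D xs p))
        = (b + of_nat (length xs) * a) * weight a b D" if "xs \<in> D" for xs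
    proof -
      have "(\<Sum>p\<le>length xs. weight a b (insert_into ?v D xs p))
          = (\<Sum>p\<le>length xs. (if p = 0 then b else a) * weight a b D)"
        by (intro sum.cong) (auto simp: weight_insert_into[OF D that])
      also have "\<dots> = (b + of_nat (length xs) * a) * weight a b D"
        unfolding lessThan_Suc_atMost[symmetric]
        by (simp only: sum.lessThan_Suc_shift) (simp add: algebra_simps)
      finally show ?thesis .
    qed
    then have "(\<Sum>xs\<in>D. \<Sum>p\<le>length xs. weight a b (insert_into ?v D xs p))
        = (\<Sum>xs\<in>D. (b + of_nat (length xs) * a) * weight a b D)"
      by simp
    \<comment> \<open>There is one front place per block, with factor \<open>b\<close>, and one
      place behind each element, with factor \<open>a\<close>.\<close>
    also have "\<dots> = (of_nat (card D) * b + of_nat (\<Sum>xs\<in>D. length xs) * a) * weight a b D"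
      by (simp add: sum.distrib sum_distrib_right[symmetric])
    also have "\<dots> = (a * of_nat N + b * of_nat l) * weight a b D"
      by (simp add: sum_length_separated_lah[OF D] separated_lahD(6)[OF D] ac_simps)
    finally show "(\<Sum>xs\<in>D. \<Sum>p\<le>length xs. weight a b (insert_into ?v D xs p))
        = (a * of_nat N + b * of_nat l) * weight a b D" .
  qed
  also have "\<dots> = (a * of_nat N + b * of_nat l) * total_weight a b r N l"
    by (simp add: total_weight_def sum_distrib_left)
  finally show ?thesis .
qed

section \<open>Initial row and identification with H_x\<close>

text \<open>If the underlying set is \<open>{1..r}\<close>, all its elements are separated from each
  other, so every block is a singleton.\<close>

lemma separated_lah_diagonal:
  "separated_lah r r l = (if l = r then {(\<lambda>i. [i]) ` {1..r}} else {})"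
proof -
  let ?D = "(\<lambda>i::nat. [i]) ` {1..r}"
  have unique: "D = ?D" if "D \<in> separated_lah r r l" for D l
  proof -
    note D = separated_lahD[OF that]
    have sing: "\<exists>i. xs = [i]" if "xs \<in> D" for xs
    proof -
      have "xs \<noteq> []" using that D(3) by auto
      then obtain i ys where xs: "xs = i # ys" by (cases xs) auto
      have "ys = []"
      proof (rule ccontr)
        assume "ys \<noteq> []"
        then have "hd ys \<in> set xs" "i \<in> set xs" using xs by auto
        moreover have "x \<le> r" if "x \<in> set xs" for x using D(8)[OF \<open>xs \<in> D\<close> that] by simp
        ultimately have "hd ys = i" using D(7)[OF that] by simp
        then show False using D(4)[OF that] xs hd_in_set[OF \<open>ys \<noteq> []\<close>] by simp
      qed
      with xs show ?thesis by simp
    qed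
    show ?thesis
    proof
      show "D \<subseteq> ?D"
      proof
        fix xs assume "xs \<in> D"
        with sing[of xs] obtain i where "xs = [i]" by blast
        with D(8)[OF \<open>xs \<in> D\<close>, of i] show "xs \<in> ?D" by simp
      qed
      show "?D \<subseteq> D"
      proof
        fix xs assume "xs \<in> ?D"
        then obtain i where i: "xs = [i]" "i \<in> {1..r}" by blast
        then obtain ys where "ys \<in> D" "i \<in> set ys" using D(2) by blast
        with sing[of ys] i show "xs \<in> D" by auto
      qed
    qed
  qed
  have card: "card ?D = r" by (simp add: card_image inj_on_def)
  moreover have "disjoint_family_on set ?D"
    unfolding disjoint_family_on_def by auto
  ultimately have member: "?D \<in> separated_lah r r r"
    by (simp add: separated_lah_def lah_distributions_iff image_iff)
  show ?thesis
  proof (cases "l = r")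
    case True
    have "separated_lah r r r = {?D}"
      using member by (intro subset_antisym subsetI) (simp_all only: singleton_iff unique)
    with True show ?thesis by simp
  next
    case False
    have "D \<notin> separated_lah r r l" for D
      using unique[of D l] separated_lahD(6)[of D r r l] card False by metis
    with False show ?thesis by auto
  qed
qed

lemma weight_singletons: "weight a b ((\<lambda>i. [i]) ` A) = 1"
  by (simp add: weight_def nrec_def rec_star_eq nonmins_def record_lows_eq)

text \<open>This is \<open>H\<^sub>x(n, k)\<close>.\<close>

fun shifted_lah :: "'a::comm_semiring_1 \<Rightarrow> 'a \<Rightarrow> 'a \<Rightarrow> nat \<Rightarrow> nat \<Rightarrow> 'a" where
  "shifted_lah a b x 0 k = (if k = 0 then 1 else 0)"
| "shifted_lah a b x (Suc n) k = (case k of 0 \<Rightarrow> 0 | Suc k' \<Rightarrow> shifted_lah a b x n k')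
     + (a * of_nat n + b * of_nat k + x) * shifted_lah a b x n k"

text \<open>With N = n + r and l = k + r, the factor a N + b l of the recurrence becomes a n + b k +
  x for x = a r + b r.\<close>

lemma total_weight_eq_shifted_lah:
  "total_weight a b r (n + r) l =
    (if r \<le> l then shifted_lah a b (a * of_nat r + b * of_nat r) n (l - r) else 0)"
proof (induction n arbitrary: l)
  case 0
  then show ?case
    by (auto simp: total_weight_def separated_lah_diagonal weight_singletons)
next
  case (Suc n)
  \<comment> \<open>For \<open>l = r\<close> the term from one block fewer is 0, because either
    \<open>l = 0\<close> or that number of blocks is below \<open>r\<close>. This matches column 0
    of \<open>shifted_lah\<close>.\<close>
  have l: "l = r \<or> l < r \<or> (\<exists>d. l = Suc (r + d))"
    using less_iff_Suc_add[of r l] by auto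
  show ?case
    using l
    by (auto simp: total_weight_Suc Suc.IH algebra_simps split: nat.splits)
qed

lemma shifted_lah_eq_0: "n < k \<Longrightarrow> shifted_lah a b x n k = 0"
  by (induction n arbitrary: k) (auto split: nat.splits)

text \<open>For \<open>k > n\<close> the left side is 0 by convention and the right side by
  \<open>shifted_lah_eq_0\<close>.\<close>

lemma gen_r_lah_eq_shifted_lah:
  "gen_r_lah a b (int n) (int k) (int r) =
    shifted_lah a b (a * of_nat r + b * of_nat r) n k"
  using total_weight_eq_shifted_lah[of a b r n "k + r"]
  by (simp add: gen_r_lah_def r_lah_distributions_eq total_weight_def weight_def shifted_lah_eq_0)

section \<open>Binomial expansion and splitting of H_x\<close>

text \<open>Induction on \<open>n\<close> with Pascal's rule, based on a n + b k + x = (a i + b k) +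
  (a (n - i) + x). The first summand advances H_0 from row i to row i + 1; the second is the next
  factor of the product.\<close>

lemma shifted_lah_binomial:
  "shifted_lah a b x n k =
    (\<Sum>i\<le>n. of_nat (n choose i) * shifted_lah a b 0 i k * (\<Prod>l<n - i. a * of_nat l + x))"
proof (induction n arbitrary: k)
  case 0
  show ?case by simp
next
  case (Suc n)
  let ?H = "shifted_lah a b 0" and ?P = "\<lambda>N. \<Prod>l<N. a * of_nat l + x"
  define pre where "pre i = (case k of 0 \<Rightarrow> 0 | Suc k' \<Rightarrow> ?H i k')" for i
  have "(\<Sum>i\<le>Suc n. of_nat (Suc n choose i) * ?H i k * ?P (Suc n - i))
      = ?H 0 k * ?P (Suc n)
        + (\<Sum>i\<le>n. of_nat (n choose Suc i) * ?H (Suc i) k * ?P (n - i))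
        + (\<Sum>i\<le>n. of_nat (n choose i) * ?H (Suc i) k * ?P (n - i))"
    by (subst sum.atMost_Suc_shift) (simp add: sum.distrib algebra_simps del: shifted_lah.simps)
  \<comment> \<open>The term for \<open>i = 0\<close>, set apart when Pascal's rule was applied,
    rejoins the sum by undoing the index shift.\<close>
  also have "?H 0 k * ?P (Suc n)
        + (\<Sum>i\<le>n. of_nat (n choose Suc i) * ?H (Suc i) k * ?P (n - i))
      = (\<Sum>i\<le>Suc n. of_nat (n choose i) * ?H i k * ?P (Suc n - i))"
    unfolding sum.atMost_Suc_shift[of "\<lambda>i. of_nat (n choose i) * ?H i k * ?P (Suc n - i)" n]
    by (simp del: shifted_lah.simps)
  also have "\<dots> = (\<Sum>i\<le>n. of_nat (n choose i) * ?H i k * ?P (Suc n - i))"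
    by (simp add: binomial_eq_0 del: shifted_lah.simps)
  also have "\<dots> + (\<Sum>i\<le>n. of_nat (n choose i) * ?H (Suc i) k * ?P (n - i))
      = (\<Sum>i\<le>n. of_nat (n choose i) * pre i * ?P (n - i)
          + (a * of_nat n + b * of_nat k + x) * (of_nat (n choose i) * ?H i k * ?P (n - i)))"
    unfolding sum.distrib[symmetric]
  proof (rule sum.cong[OF refl])
    fix i assume "i \<in> {..n}"
    then obtain d where d: "n = i + d" using le_Suc_ex by auto
    show "of_nat (n choose i) * ?H i k * ?P (Suc n - i)
        + of_nat (n choose i) * ?H (Suc i) k * ?P (n - i)
      = of_nat (n choose i) * pre i * ?P (n - i)
        + (a * of_nat n + b * of_nat k + x) * (of_nat (n choose i) * ?H i k * ?P (n - i))"
      unfolding d pre_def by (simp add: Suc_diff_le algebra_simps)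
  qed
  also have "\<dots> = (case k of 0 \<Rightarrow> 0 | Suc k' \<Rightarrow> shifted_lah a b x n k')
      + (a * of_nat n + b * of_nat k + x) * shifted_lah a b x n k"
    by (simp add: sum.distrib sum_distrib_left[symmetric] Suc.IH pre_def split: nat.splits)
  finally show ?case by simp
qed

text \<open>Induction on \<open>n\<close>. By a n + b (k - j) + (a m + b j + x) = a (n + m) + b k +
  x, each summand obeys the recurrence of H_x from row m on. At \<open>n = 0\<close> only
  \<open>j = k\<close> survives, which leaves row m itself.\<close>

lemma shifted_lah_add:
  "shifted_lah a b x (n + m) k =
    (\<Sum>j\<le>m. shifted_lah a b x m j *
      (if j \<le> k then shifted_lah a b (a * of_nat m + b * of_nat j + x) n (k - j) else 0))"
proof (induction n arbitrary: k)
  case 0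
  have "(\<Sum>j\<le>m. shifted_lah a b x m j *
      (if j \<le> k then shifted_lah a b (a * of_nat m + b * of_nat j + x) 0 (k - j) else 0))
    = (\<Sum>j\<le>m. if j = k then shifted_lah a b x m j else 0)"
    by (intro sum.cong) auto
  then show ?case by (auto simp: shifted_lah_eq_0)
next
  case (Suc n)
  \<comment> \<open>The value 0 for \<open>k < j\<close> makes the term from column
    \<open>k - 1\<close> vanish at \<open>k = j\<close>, as the recurrence demands in column
    0.\<close>
  define F where
    "F j k = (if j \<le> k then shifted_lah a b (a * of_nat m + b * of_nat j + x) n (k - j) else 0)"
    for j k
  have F: "(if j \<le> k then shifted_lah a b (a * of_nat m + b * of_nat j + x) (Suc n) (k - j) else 0)
      = (case k of 0 \<Rightarrow> 0 | Suc k' \<Rightarrow> F j k') + (a * of_nat (n + m) + b * of_nat k + x) * F j k" for j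
  proof -
    consider "k < j" | "k = j" | d where "k = Suc (j + d)"
      using less_iff_Suc_add[of j k] by fastforce
    then show ?thesis
      by cases (auto simp: F_def algebra_simps Suc_diff_le split: nat.splits)
  qed
  have IH: "shifted_lah a b x (n + m) k = (\<Sum>j\<le>m. shifted_lah a b x m j * F j k)" for k
    using Suc.IH[of k] by (simp add: F_def)
  have "shifted_lah a b x (Suc n + m) k =
      (\<Sum>j\<le>m. shifted_lah a b x m j * (case k of 0 \<Rightarrow> 0 | Suc k' \<Rightarrow> F j k'))
        + (a * of_nat (n + m) + b * of_nat k + x) * (\<Sum>j\<le>m. shifted_lah a b x m j * F j k)"
    unfolding add_Suc shifted_lah.simps IH by (simp split: nat.split)
  then show ?case
    unfolding F distrib_left[of "shifted_lah a b x m _"] sum.distrib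
    by (simp add: sum_distrib_left mult.left_commute)
qed

section \<open>Return from H_x to the generalized r-Lah numbers\<close>

theorem theorem2p5:
  fixes a b :: "'a::comm_semiring_1" and n m k r :: nat
  shows "gen_r_lah a b (int n + int m) (int k) (int r) =
    (\<Sum>i=0..n. \<Sum>j=0..m.
       of_nat (n choose i) * gen_r_lah a b (int m) (int j) (int r)
         * gen_r_lah a b (int i) (int k - int j) 0
         * (\<Prod>l\<in>{0..<n - i}. a * of_nat l + a * of_nat (m + r) + b * of_nat (j + r)))"
proof -
  let ?x = "a * of_nat r + b * of_nat r"
  let ?y = "\<lambda>j. a * of_nat m + b * of_nat j + ?x"
  \<comment> \<open>For \<open>j > k\<close> the integer index is negative and the convention gives
    0; otherwise r = 0 makes the shift x vanish.\<close>
  have zero: "gen_r_lah a b (int i) (int k - int j) 0 =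
      (if j \<le> k then shifted_lah a b 0 i (k - j) else 0)" for i j
  proof (cases "j \<le> k")
    case True
    then show ?thesis
      using gen_r_lah_eq_shifted_lah[of a b i "k - j" 0] by (simp add: of_nat_diff)
  qed (simp add: gen_r_lah_def)
  have "gen_r_lah a b (int n + int m) (int k) (int r) = shifted_lah a b ?x (n + m) k"
    using gen_r_lah_eq_shifted_lah[of a b "n + m" k r] by simp
  also have "\<dots> = (\<Sum>j\<le>m. shifted_lah a b ?x m j *
      (if j \<le> k then shifted_lah a b (?y j) n (k - j) else 0))"
    by (rule shifted_lah_add)
  \<comment> \<open>The expansion is used with shift \<open>?y j\<close>, which equals a (m + r) + b
    (j + r).\<close>
  also have "\<dots> = (\<Sum>j\<le>m. \<Sum>i\<le>n. of_nat (n choose i) * shifted_lah a b ?x m j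
      * (if j \<le> k then shifted_lah a b 0 i (k - j) else 0) * (\<Prod>l<n - i. a * of_nat l + ?y j))"
    by (intro sum.cong refl)
       (simp add: shifted_lah_binomial[of a b "?y _"] sum_distrib_left mult.assoc mult.left_commute)
  also have "\<dots> = (\<Sum>i\<le>n. \<Sum>j\<le>m. of_nat (n choose i) * shifted_lah a b ?x m j
      * (if j \<le> k then shifted_lah a b 0 i (k - j) else 0) * (\<Prod>l<n - i. a * of_nat l + ?y j))"
    by (rule sum.swap)
  finally show ?thesis
    by (simp add: zero gen_r_lah_eq_shifted_lah atLeast0AtMost atLeast0LessThan algebra_simps)
qed

end
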